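(* Let $d\ge 1$ and $k\ge 0$ be integers and let $\lambda$ be a linear functional on $\Pi=\Pi(\mathbb{R}^d)$. If $\lambda\perp\Pi_{<k}$, then $$(-1)^k(\lambda\otimes\lambda)\|x-y\|^{2k}\ \ge\ 0,$$ with equality if and only if $\lambda\perp\Pi_{\le k}$.
   Context: $\Pi=\Pi(\mathbb{R}^d)$ is the real vector space of all polynomials with real coefficients in $d$ real variables. $\Pi_{\le k}$ (resp. $\Pi_{<k}$) is the subspace of polynomials of total degree $\le k$ (resp. $<k$); $\Pi_{<0}=\{0\}$. For a linear functional $\lambda$ on $\Pi$ (any element of the algebraic dual $\Pi'$) and a subspace $V\subseteq\Pi$, $\lambda\perp V$ means that $\lambda$ vanishes on $V$. $\|\cdot\|$ is the Euclidean norm on $\mathbb{R}^d$. For linear functionals $\lambda,\mu$ on $\Pi$, $\lambda\otimes\mu:\Pi\otimes\Pi\to\mathbb{R}$ is the linear map determined by $x^\alpha\otimes y^\beta\mapsto \lambda(()^\alpha)\,\mu(()^\beta)$ for all multi-indices $\alpha,\beta\in\mathbb{Z}_+^d$, where $()^\alpha$ denotes the monomial $x\mapsto x(1)^{\alpha(1)}\cdots x(d)^{\alpha(d)}$ and $\Pi\otimes\Pi$ is identified with the polynomials in $(x,y)\in\mathbb{R}^d\times\mathbb{R}^d$. Thus $(\lambda\otimes\mu)\|x-y\|^{2k}$ is the number obtained from the polynomial $(x,y)\mapsto\|x-y\|^{2k}$ by applying $\lambda$ to it as a polynomial in $x$ and $\mu$ to it as a polynomial in $y$. *)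

theory Defs
  imports "HOL-Analysis.Analysis" "HOL-Analysis.Finite_Function_Topology"
begin

text \<open>A polynomial is the finitely supported map from its exponent vectors to its coefficients, with
  the convolution product of Poly_Mapping and the vector space structure of
  Finite_Function_Topology. Polynomials on \<open>real ^ 'n\<close> have variables indexed by \<open>'n\<close>;
  those on \<open>real ^ 'n \<times> real ^ 'n\<close> have variables indexed by \<open>'n + 'n\<close>, \<open>Inl i\<close> standing for
  the \<open>i\<close>-th coordinate of \<open>x\<close> and \<open>Inr i\<close> for that of \<open>y\<close>.\<close>

type_synonym 'v rpoly = "('v \<Rightarrow>\<^sub>0 nat) \<Rightarrow>\<^sub>0 real"

definition monomial :: "('v \<Rightarrow>\<^sub>0 nat) \<Rightarrow> 'v rpoly" where
  "monomial \<alpha> = Poly_Mapping.single \<alpha> 1"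

definition var :: "'v \<Rightarrow> 'v rpoly" where
  "var v = monomial (Poly_Mapping.single v 1)"

definition total_deg :: "('v::finite \<Rightarrow>\<^sub>0 nat) \<Rightarrow> nat" where
  "total_deg \<alpha> = (\<Sum>v\<in>UNIV. Poly_Mapping.lookup \<alpha> v)"

definition polys_le :: "nat \<Rightarrow> 'v::finite rpoly set" where
  "polys_le k = {p. \<forall>\<alpha>\<in>Poly_Mapping.keys p. total_deg \<alpha> \<le> k}"

definition polys_less :: "nat \<Rightarrow> 'v::finite rpoly set" where
  "polys_less k = {p. \<forall>\<alpha>\<in>Poly_Mapping.keys p. total_deg \<alpha> < k}"

definition annihilates :: "('v rpoly \<Rightarrow> real) \<Rightarrow> 'v rpoly set \<Rightarrow> bool" (infix "\<bottom>\<^sub>f" 50) where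
  "\<nu> \<bottom>\<^sub>f V \<longleftrightarrow> (\<forall>p\<in>V. \<nu> p = 0)"

text \<open>\<open>map_key Inl \<gamma>\<close> and \<open>map_key Inr \<gamma>\<close> are the restrictions of \<open>\<gamma>\<close> to the \<open>x\<close>- and to the
  \<open>y\<close>-variables, so that \<open>monomial \<gamma>\<close> is the monomial with \<open>x\<close>-exponent \<open>map_key Inl \<gamma>\<close> and
  \<open>y\<close>-exponent \<open>map_key Inr \<gamma>\<close>.\<close>

definition tensor_functional ::
  "('n rpoly \<Rightarrow> real) \<Rightarrow> ('n rpoly \<Rightarrow> real) \<Rightarrow> ('n + 'n) rpoly \<Rightarrow> real" (infixl "\<otimes>\<^sub>f" 70) where
  "(\<nu> \<otimes>\<^sub>f \<mu>) p = (\<Sum>\<gamma>\<in>Poly_Mapping.keys p. Poly_Mapping.lookup p \<gamma> *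
     (\<nu> (monomial (Poly_Mapping.map_key Inl \<gamma>)) * \<mu> (monomial (Poly_Mapping.map_key Inr \<gamma>))))"

definition sqdist_poly :: "('n::finite + 'n) rpoly" where
  "sqdist_poly = (\<Sum>i\<in>UNIV. (var (Inl i) - var (Inr i))\<^sup>2)"

definition peval :: "('v::finite \<Rightarrow> real) \<Rightarrow> 'v rpoly \<Rightarrow> real" where
  "peval a p = (\<Sum>\<alpha>\<in>Poly_Mapping.keys p.
     Poly_Mapping.lookup p \<alpha> * (\<Prod>v\<in>UNIV. a v ^ Poly_Mapping.lookup \<alpha> v))"

lemma polys_less_0: "polys_less 0 = {0}"
  by (auto simp: polys_less_def simp flip: keys_eq_empty)

lemma lookup_scaleR_rpoly [simp]:
  "Poly_Mapping.lookup (c *\<^sub>R (p :: 'v rpoly)) \<alpha> = c * Poly_Mapping.lookup p \<alpha>"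
proof -
  have "finite {\<alpha>. c * Poly_Mapping.lookup p \<alpha> \<noteq> 0}"
    by (rule finite_subset[OF _ finite_keys[of p]]) (auto simp: in_keys_iff)
  then show ?thesis
    by (simp add: scaleR_poly_mapping_def)
qed

lemma rpoly_eq_sum_monomial:
  fixes p :: "'v rpoly"
  shows "p = (\<Sum>\<alpha>\<in>Poly_Mapping.keys p. Poly_Mapping.lookup p \<alpha> *\<^sub>R monomial \<alpha>)"
proof (rule poly_mapping_eqI)
  fix \<beta>
  have "(\<Sum>\<alpha>\<in>Poly_Mapping.keys p. Poly_Mapping.lookup p \<alpha> * (1 when \<alpha> = \<beta>)) =
      (\<Sum>\<alpha>\<in>Poly_Mapping.keys p. if \<alpha> = \<beta> then Poly_Mapping.lookup p \<alpha> else 0)"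
    by (rule sum.cong) (auto simp: when_def)
  also have "\<dots> = Poly_Mapping.lookup p \<beta>"
    by (simp add: in_keys_iff)
  finally show "Poly_Mapping.lookup p \<beta> = Poly_Mapping.lookup
      (\<Sum>\<alpha>\<in>Poly_Mapping.keys p. Poly_Mapping.lookup p \<alpha> *\<^sub>R monomial \<alpha>) \<beta>"
    by (simp add: lookup_sum monomial_def lookup_single)
qed

lemma linear_coeff_sum:
  fixes w :: "('v \<Rightarrow>\<^sub>0 nat) \<Rightarrow> real"
  shows "linear (\<lambda>p :: 'v rpoly. \<Sum>\<alpha>\<in>Poly_Mapping.keys p. Poly_Mapping.lookup p \<alpha> * w \<alpha>)"
    (is "linear ?f")
proof (rule linearI)
  fix p q :: "'v rpoly" and c :: real
  show "?f (p + q) = ?f p + ?f q"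
    by (rule setsum_keys_plus_distrib) (simp_all add: algebra_simps)
  have "?f (c *\<^sub>R p) = (\<Sum>\<alpha>\<in>Poly_Mapping.keys p. Poly_Mapping.lookup (c *\<^sub>R p) \<alpha> * w \<alpha>)"
    by (rule sum.mono_neutral_left) (auto simp: in_keys_iff)
  also have "\<dots> = c *\<^sub>R ?f p"
    by (simp add: sum_distrib_left mult.assoc)
  finally show "?f (c *\<^sub>R p) = c *\<^sub>R ?f p" .
qed

lemma linear_eq_on_monomial:
  fixes f g :: "'v rpoly \<Rightarrow> real"
  assumes "linear f" "linear g" "\<And>\<alpha>. f (monomial \<alpha>) = g (monomial \<alpha>)"
  shows "f = g"
proof
  fix p
  have "f (\<Sum>\<alpha>\<in>Poly_Mapping.keys p. Poly_Mapping.lookup p \<alpha> *\<^sub>R monomial \<alpha>) =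
        g (\<Sum>\<alpha>\<in>Poly_Mapping.keys p. Poly_Mapping.lookup p \<alpha> *\<^sub>R monomial \<alpha>)"
    using assms by (simp add: linear_sum linear_scale)
  then show "f p = g p"
    by (simp flip: rpoly_eq_sum_monomial)
qed

text \<open>The tensor product is the unique linear map with the prescribed values on monomials.\<close>

lemma tensor_functional_unique:
  "T = \<nu> \<otimes>\<^sub>f \<mu> \<longleftrightarrow> linear T \<and> (\<forall>\<gamma>. T (monomial \<gamma>) =
     \<nu> (monomial (Poly_Mapping.map_key Inl \<gamma>)) * \<mu> (monomial (Poly_Mapping.map_key Inr \<gamma>)))"
proof -
  have lin: "linear (\<nu> \<otimes>\<^sub>f \<mu>)"
    unfolding tensor_functional_def[abs_def] by (rule linear_coeff_sum)
  moreover have "(\<nu> \<otimes>\<^sub>f \<mu>) (monomial \<gamma>) =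
      \<nu> (monomial (Poly_Mapping.map_key Inl \<gamma>)) * \<mu> (monomial (Poly_Mapping.map_key Inr \<gamma>))" for \<gamma>
    by (simp add: tensor_functional_def monomial_def[of \<gamma>])
  ultimately show ?thesis
    by (auto intro: linear_eq_on_monomial)
qed

lemma linear_peval: "linear (peval a)"
  unfolding peval_def[abs_def] by (rule linear_coeff_sum)

lemma peval_monomial: "peval a (monomial \<alpha>) = (\<Prod>v\<in>UNIV. a v ^ Poly_Mapping.lookup \<alpha> v)"
  by (simp add: peval_def monomial_def)

lemma peval_mult:
  fixes p q :: "'v::finite rpoly"
  shows "peval a (p * q) = peval a p * peval a q"
proof -
  have scl: "(c *\<^sub>R monomial \<alpha>) * (d *\<^sub>R monomial \<beta>) = (c * d) *\<^sub>R (monomial (\<alpha> + \<beta>) :: 'v rpoly)"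
    for c d :: real and \<alpha> \<beta> :: "'v \<Rightarrow>\<^sub>0 nat"
  proof -
    have s: "c *\<^sub>R monomial \<alpha> = Poly_Mapping.single \<alpha> c" for c and \<alpha> :: "'v \<Rightarrow>\<^sub>0 nat"
      by (rule poly_mapping_eqI) (simp add: monomial_def lookup_single when_def)
    show ?thesis by (simp add: s mult_single)
  qed
  define P where "P = Poly_Mapping.keys p"
  define Q where "Q = Poly_Mapping.keys q"
  define c where "c = Poly_Mapping.lookup p"
  define d where "d = Poly_Mapping.lookup q"
  have p: "p = (\<Sum>\<alpha>\<in>P. c \<alpha> *\<^sub>R monomial \<alpha>)" and q: "q = (\<Sum>\<alpha>\<in>Q. d \<alpha> *\<^sub>R monomial \<alpha>)"
    unfolding P_def Q_def c_def d_def by (rule rpoly_eq_sum_monomial)+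
  show ?thesis
    unfolding p q
    by (simp add: sum_product scl linear_sum[OF linear_peval] linear_scale[OF linear_peval]
      peval_monomial lookup_add power_add prod.distrib mult_ac)
qed

text \<open>\<open>sqdist_poly ^ k\<close> has the polynomial function \<open>(x, y) \<mapsto> norm (x - y) ^ (2 * k)\<close>.\<close>

lemma peval_sqdist_poly_power:
  fixes x y :: "real ^ 'n"
  shows "peval (case_sum (\<lambda>i. x $ i) (\<lambda>i. y $ i)) (sqdist_poly ^ k) = norm (x - y) ^ (2 * k)"
proof -
  let ?a = "case_sum (\<lambda>i. x $ i) (\<lambda>i. y $ i)"
  have one: "peval ?a 1 = 1"
    using peval_monomial[of ?a 0] by (simp add: monomial_def)
  have pow: "peval ?a (p ^ m) = peval ?a p ^ m" for p m
    by (induction m) (simp_all add: one peval_mult)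
  have var: "peval ?a (var v) = ?a v" for v
  proof -
    have "(\<Prod>w\<in>UNIV. ?a w ^ Poly_Mapping.lookup (Poly_Mapping.single v 1) w) =
          (\<Prod>w\<in>UNIV. if v = w then ?a w else 1)"
      by (rule prod.cong) (auto simp: lookup_single)
    then show ?thesis by (simp add: var_def peval_monomial)
  qed
  have "peval ?a sqdist_poly = (\<Sum>i\<in>UNIV. (x $ i - y $ i)\<^sup>2)"
    by (simp add: sqdist_poly_def linear_sum[OF linear_peval] pow linear_diff[OF linear_peval] var)
  also have "\<dots> = (norm (x - y))\<^sup>2"
    by (simp add: norm_vec_def L2_set_def sum_nonneg)
  finally show ?thesis
    by (simp add: pow power_mult)
qed

end

theory Submission
  imports Defs
begin

text \<open>Write \<open>\<parallel>x - y\<parallel>\<^sup>2 = A + B - 2 C\<close> with \<open>A = \<parallel>x\<parallel>\<^sup>2\<close>, \<open>B = \<parallel>y\<parallel>\<^sup>2\<close> and \<open>C = \<langle>x, y\<rangle>\<close>,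
  and expand the \<open>k\<close>-th power. The term \<open>A\<^sup>j B\<^sup>n C\<^sup>m\<close>, \<open>m + j + n = k\<close>, has degree \<open>m + 2 j\<close> in \<open>x\<close>
  and \<open>m + 2 n\<close> in \<open>y\<close>; unless \<open>j = n\<close> one of these is below \<open>k\<close> and the term is annihilated.
  If \<open>j = n\<close>, then \<open>m\<close> has the parity of \<open>k\<close>, so that \<open>(-1)\<^sup>k (-2)\<^sup>m > 0\<close>, and the tensor square
  of the functional is a sum of squares at \<open>A\<^sup>j B\<^sup>j C\<^sup>m\<close>. The squares coming from \<open>C\<^sup>k\<close> are those
  of the values at all monomials of degree \<open>k\<close>.\<close>

section \<open>Transposed multiplication on functionals, and the pieces of the squared
  distance\<close>

definition mult_dual :: "'v rpoly \<Rightarrow> ('v rpoly \<Rightarrow> real) \<Rightarrow> 'v rpoly \<Rightarrow> real" where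
  "mult_dual p \<nu> = (\<lambda>r. \<nu> (p * r))"

text \<open>For a linear \<open>\<nu>\<close> this is vanishing on the homogeneous polynomials of
  degree \<open>m\<close>; testing monomials of one exact degree suits induction on
  \<open>m\<close>.\<close>

definition kills_degree :: "('v::finite rpoly \<Rightarrow> real) \<Rightarrow> nat \<Rightarrow> bool" where
  "kills_degree \<nu> m \<longleftrightarrow> (\<forall>\<alpha>. total_deg \<alpha> = m \<longrightarrow> \<nu> (monomial \<alpha>) = 0)"

text \<open>The map \<open>f\<close> selects the block of variables: \<open>Inl\<close> gives A,
  \<open>Inr\<close> gives B, and the identity gives their common counterpart in the variables of a
  single factor.\<close>

definition sqnorm :: "('n \<Rightarrow> 'v) \<Rightarrow> 'v rpoly" where
  "sqnorm f = (\<Sum>i\<in>UNIV. var (f i) ^ 2)"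

definition inner_poly :: "('n::finite + 'n) rpoly" where
  "inner_poly = (\<Sum>i\<in>UNIV. var (Inl i) * var (Inr i))"

lemma sqdist_poly_eq:
  "sqdist_poly = of_int (-2) * inner_poly + (sqnorm Inl + sqnorm Inr :: ('n::finite + 'n) rpoly)"
  unfolding sqdist_poly_def inner_poly_def sqnorm_def
  by (simp add: sum_distrib_left power2_eq_square algebra_simps sum.distrib sum_subtractf sum_negf)

text \<open>Bridges the vector space structure and the convolution ring, which are defined
  independently.\<close>

lemma scaleR_eq_mult: "c *\<^sub>R (p :: 'v rpoly) = Poly_Mapping.single 0 c * p"
  by (rule poly_mapping_eqI) (simp add: Poly_Mapping.map.rep_eq when_def flip: mult_map_scale_conv_mult)

lemma mult_scaleR_rpoly: "(p :: 'v rpoly) * (c *\<^sub>R q) = c *\<^sub>R (p * q)"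
  by (simp add: scaleR_eq_mult mult.left_commute)

lemma linear_mult_dual: "linear \<nu> \<Longrightarrow> linear (mult_dual p \<nu>)"
  unfolding mult_dual_def
  by (rule linearI)
     (simp_all add: linear_add distrib_left mult_scaleR_rpoly linear_scale)

lemma linear_of_int_mult:
  fixes T :: "'v rpoly \<Rightarrow> real"
  assumes "linear T"
  shows "T (of_int c * p) = of_int c * T p"
proof -
  have "of_int c * p = of_int c *\<^sub>R p"
    by (simp add: scaleR_eq_mult flip: single_of_int)
  with assms show ?thesis by (simp add: linear_scale)
qed

lemma mult_dual_one [simp]: "mult_dual 1 \<nu> = \<nu>"
  by (simp add: mult_dual_def)

lemma mult_dual_mult: "mult_dual (p * q) \<nu> = mult_dual q (mult_dual p \<nu>)"
  by (simp add: mult_dual_def mult.assoc)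

lemma mult_dual_sum:
  "linear \<nu> \<Longrightarrow> mult_dual (\<Sum>i\<in>I. f i) \<nu> r = (\<Sum>i\<in>I. mult_dual (f i) \<nu> r)"
  by (simp add: mult_dual_def sum_distrib_right linear_sum)

lemma var_mult_monomial: "var v * monomial \<alpha> = monomial (Poly_Mapping.single v 1 + \<alpha>)"
  by (simp add: var_def monomial_def mult_single)

section \<open>Moving factors from the tensor product to its two functionals\<close>

lemma linear_tensor: "linear (\<nu> \<otimes>\<^sub>f \<mu>)"
  using tensor_functional_unique by blast

lemma tensor_monomial: "(\<nu> \<otimes>\<^sub>f \<mu>) (monomial \<gamma>) =
     \<nu> (monomial (Poly_Mapping.map_key Inl \<gamma>)) * \<mu> (monomial (Poly_Mapping.map_key Inr \<gamma>))"
  using tensor_functional_unique by blast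

lemma map_key_single_other:
  "inj f \<Longrightarrow> v \<notin> range f \<Longrightarrow> Poly_Mapping.map_key f (Poly_Mapping.single v c) = 0"
  by (rule poly_mapping_eqI) (auto simp: map_key.rep_eq lookup_single when_def)

text \<open>Multiplying a monomial by an x-variable shifts its x-exponent and leaves its y-exponent
  alone.\<close>

lemma tensor_var_Inl: "mult_dual (var (Inl i)) (\<nu> \<otimes>\<^sub>f \<mu>) = mult_dual (var i) \<nu> \<otimes>\<^sub>f \<mu>"
proof (rule linear_eq_on_monomial)
  fix \<gamma> :: "'a + 'a \<Rightarrow>\<^sub>0 nat"
  show "mult_dual (var (Inl i)) (\<nu> \<otimes>\<^sub>f \<mu>) (monomial \<gamma>) = (mult_dual (var i) \<nu> \<otimes>\<^sub>f \<mu>) (monomial \<gamma>)"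
    by (simp add: mult_dual_def var_mult_monomial tensor_monomial map_key_plus map_key_single
        map_key_single_other image_iff)
qed (intro linear_mult_dual linear_tensor)+

lemma tensor_var_Inr: "mult_dual (var (Inr i)) (\<nu> \<otimes>\<^sub>f \<mu>) = \<nu> \<otimes>\<^sub>f mult_dual (var i) \<mu>"
proof (rule linear_eq_on_monomial)
  fix \<gamma> :: "'a + 'a \<Rightarrow>\<^sub>0 nat"
  show "mult_dual (var (Inr i)) (\<nu> \<otimes>\<^sub>f \<mu>) (monomial \<gamma>) = (\<nu> \<otimes>\<^sub>f mult_dual (var i) \<mu>) (monomial \<gamma>)"
    by (simp add: mult_dual_def var_mult_monomial tensor_monomial map_key_plus map_key_single
        map_key_single_other image_iff)
qed (intro linear_mult_dual linear_tensor)+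

lemma tensor_sqnorm_Inl:
  assumes "linear \<nu>"
  shows "mult_dual (sqnorm Inl) (\<nu> \<otimes>\<^sub>f \<mu>) = mult_dual (sqnorm (\<lambda>i. i)) \<nu> \<otimes>\<^sub>f \<mu>"
proof (rule linear_eq_on_monomial)
  fix \<gamma> :: "'a + 'a \<Rightarrow>\<^sub>0 nat"
  show "mult_dual (sqnorm Inl) (\<nu> \<otimes>\<^sub>f \<mu>) (monomial \<gamma>) =
      (mult_dual (sqnorm (\<lambda>i. i)) \<nu> \<otimes>\<^sub>f \<mu>) (monomial \<gamma>)"
    using assms
    by (simp add: sqnorm_def mult_dual_sum linear_tensor power2_eq_square mult_dual_mult
        tensor_var_Inl tensor_monomial sum_distrib_right)
qed (intro linear_mult_dual linear_tensor)+

lemma tensor_sqnorm_Inr: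
  assumes "linear \<mu>"
  shows "mult_dual (sqnorm Inr) (\<nu> \<otimes>\<^sub>f \<mu>) = \<nu> \<otimes>\<^sub>f mult_dual (sqnorm (\<lambda>i. i)) \<mu>"
proof (rule linear_eq_on_monomial)
  fix \<gamma> :: "'a + 'a \<Rightarrow>\<^sub>0 nat"
  show "mult_dual (sqnorm Inr) (\<nu> \<otimes>\<^sub>f \<mu>) (monomial \<gamma>) =
      (\<nu> \<otimes>\<^sub>f mult_dual (sqnorm (\<lambda>i. i)) \<mu>) (monomial \<gamma>)"
    using assms
    by (simp add: sqnorm_def mult_dual_sum linear_tensor power2_eq_square mult_dual_mult
        tensor_var_Inr tensor_monomial sum_distrib_left)
qed (intro linear_mult_dual linear_tensor)+

lemma tensor_sqnorm_Inl_power: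
  assumes "linear \<nu>"
  shows "mult_dual (sqnorm Inl ^ j) (\<nu> \<otimes>\<^sub>f \<mu>) = mult_dual (sqnorm (\<lambda>i. i) ^ j) \<nu> \<otimes>\<^sub>f \<mu>"
  using assms
  by (induction j arbitrary: \<nu>) (simp_all add: mult_dual_mult tensor_sqnorm_Inl linear_mult_dual)

lemma tensor_sqnorm_Inr_power:
  assumes "linear \<mu>"
  shows "mult_dual (sqnorm Inr ^ j) (\<nu> \<otimes>\<^sub>f \<mu>) = \<nu> \<otimes>\<^sub>f mult_dual (sqnorm (\<lambda>i. i) ^ j) \<mu>"
  using assms
  by (induction j arbitrary: \<mu>) (simp_all add: mult_dual_mult tensor_sqnorm_Inr linear_mult_dual)

text \<open>The recursion behind every induction on powers of C: removing one factor C passes the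
  same variable to both functionals, so a tensor square becomes a sum of tensor squares.\<close>

lemma tensor_inner_poly_mult:
  "(\<nu> \<otimes>\<^sub>f \<mu>) (inner_poly * r) = (\<Sum>i\<in>UNIV. (mult_dual (var i) \<nu> \<otimes>\<^sub>f mult_dual (var i) \<mu>) r)"
proof -
  have "(\<nu> \<otimes>\<^sub>f \<mu>) (inner_poly * r) = mult_dual inner_poly (\<nu> \<otimes>\<^sub>f \<mu>) r"
    by (simp add: mult_dual_def)
  also have "\<dots> = (\<Sum>i\<in>UNIV. (mult_dual (var i) \<nu> \<otimes>\<^sub>f mult_dual (var i) \<mu>) r)"
    by (simp add: inner_poly_def mult_dual_sum linear_tensor mult_dual_mult tensor_var_Inl
        tensor_var_Inr)
  finally show ?thesis .
qed

lemma tensor_one: "(\<nu> \<otimes>\<^sub>f \<mu>) 1 = \<nu> 1 * \<mu> 1"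
  using tensor_monomial[of \<nu> \<mu> 0] by (simp add: monomial_def)

section \<open>Degrees of monomials and vanishing in a fixed degree\<close>

lemma total_deg_single_add: "total_deg (Poly_Mapping.single v 1 + \<alpha>) = Suc (total_deg \<alpha>)"
  by (simp add: total_deg_def lookup_add sum.distrib lookup_single when_def)

lemma total_deg_eq_0_iff: "total_deg \<alpha> = 0 \<longleftrightarrow> \<alpha> = 0"
  by (auto simp: total_deg_def intro!: poly_mapping_eqI)

lemma total_deg_SucE:
  assumes "total_deg \<alpha> = Suc m"
  obtains v \<beta> where "\<alpha> = Poly_Mapping.single v 1 + \<beta>" "total_deg \<beta> = m"
proof -
  have "\<alpha> \<noteq> 0"
    using assms by (metis total_deg_eq_0_iff nat.distinct(1))
  then obtain v where v: "Poly_Mapping.lookup \<alpha> v \<noteq> 0"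
    by (metis poly_mapping_eqI lookup_zero)
  define \<beta> where "\<beta> = \<alpha> - Poly_Mapping.single v 1"
  have "\<alpha> = Poly_Mapping.single v 1 + \<beta>"
    using v by (intro poly_mapping_eqI) (auto simp: \<beta>_def lookup_add lookup_minus lookup_single when_def)
  moreover from this have "total_deg \<beta> = m"
    using assms total_deg_single_add[of v \<beta>] by simp
  ultimately show ?thesis by (rule that)
qed

lemma kills_degree_0_iff: "kills_degree \<nu> 0 \<longleftrightarrow> \<nu> 1 = 0"
  by (simp add: kills_degree_def total_deg_eq_0_iff monomial_def)

text \<open>The monomials of degree \<open>Suc m\<close> are exactly the products of a variable and
  a monomial of degree \<open>m\<close>. This recursion runs parallel to the one for powers of
  C.\<close>

lemma kills_degree_Suc_iff:
  "kills_degree \<nu> (Suc m) \<longleftrightarrow> (\<forall>i. kills_degree (mult_dual (var i) \<nu>) m)"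
  unfolding kills_degree_def mult_dual_def var_mult_monomial
  by (metis total_deg_SucE total_deg_single_add)

lemma kills_degree_sqnorm:
  assumes "linear \<nu>" "kills_degree \<nu> (m + 2)"
  shows "kills_degree (mult_dual (sqnorm (\<lambda>i. i)) \<nu>) m"
  using assms
  by (simp add: kills_degree_Suc_iff numeral_2_eq_2)
     (simp add: kills_degree_def sqnorm_def mult_dual_sum power2_eq_square mult_dual_mult)

lemma kills_degree_sqnorm_power:
  assumes "linear \<nu>" "kills_degree \<nu> (m + 2 * j)"
  shows "kills_degree (mult_dual (sqnorm (\<lambda>i. i) ^ j) \<nu>) m"
  using assms
proof (induction j arbitrary: \<nu>)
  case (Suc j)
  then show ?case
    using kills_degree_sqnorm[of \<nu> "m + 2 * j"]
    by (simp add: mult_dual_mult linear_mult_dual)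
qed simp

section \<open>The tensor product at powers of the inner product\<close>

lemma tensor_inner_power_eq_0:
  assumes "kills_degree \<nu> m \<or> kills_degree \<mu> m"
  shows "(\<nu> \<otimes>\<^sub>f \<mu>) (inner_poly ^ m) = 0"
  using assms
proof (induction m arbitrary: \<nu> \<mu>)
  case 0
  then show ?case by (auto simp: tensor_one kills_degree_0_iff)
next
  case (Suc m)
  then show ?case
    by (auto simp: tensor_inner_poly_mult kills_degree_Suc_iff intro!: sum.neutral)
qed

text \<open>Unrolling the recursion gives a sum of squares of values of \<open>\<nu>\<close> at
  products of \<open>m\<close> variables.\<close>

lemma tensor_inner_power_nonneg: "(\<nu> \<otimes>\<^sub>f \<nu>) (inner_poly ^ m) \<ge> 0"
  by (induction m arbitrary: \<nu>) (simp_all add: tensor_one tensor_inner_poly_mult sum_nonneg)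

text \<open>A sum of nonnegative terms vanishes only if each term does, so the two recursions agree
  step by step.\<close>

lemma tensor_inner_power_eq_0_iff:
  "(\<nu> \<otimes>\<^sub>f \<nu>) (inner_poly ^ m) = 0 \<longleftrightarrow> kills_degree \<nu> m"
  by (induction m arbitrary: \<nu>)
     (simp_all add: tensor_one tensor_inner_poly_mult kills_degree_0_iff kills_degree_Suc_iff
       sum_nonneg_eq_0_iff tensor_inner_power_nonneg)

section \<open>Annihilation conditions read degree by degree\<close>

lemma annihilates_keys_iff:
  assumes "linear \<nu>"
  shows "\<nu> \<bottom>\<^sub>f {p. \<forall>\<alpha>\<in>Poly_Mapping.keys p. P \<alpha>} \<longleftrightarrow> (\<forall>\<alpha>. P \<alpha> \<longrightarrow> \<nu> (monomial \<alpha>) = 0)"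
proof
  assume *: "\<forall>\<alpha>. P \<alpha> \<longrightarrow> \<nu> (monomial \<alpha>) = 0"
  show "\<nu> \<bottom>\<^sub>f {p. \<forall>\<alpha>\<in>Poly_Mapping.keys p. P \<alpha>}"
    unfolding annihilates_def
  proof safe
    fix p :: "'a rpoly" assume p: "\<forall>\<alpha>\<in>Poly_Mapping.keys p. P \<alpha>"
    have "\<nu> p = \<nu> (\<Sum>\<alpha>\<in>Poly_Mapping.keys p. Poly_Mapping.lookup p \<alpha> *\<^sub>R monomial \<alpha>)"
      by (simp flip: rpoly_eq_sum_monomial)
    also have "\<dots> = 0"
      using * p by (simp add: linear_sum[OF assms] linear_scale[OF assms])
    finally show "\<nu> p = 0" .
  qed
qed (simp add: annihilates_def monomial_def)

lemma annihilates_polys_less_iff: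
  "linear \<nu> \<Longrightarrow> \<nu> \<bottom>\<^sub>f polys_less k \<longleftrightarrow> (\<forall>m<k. kills_degree \<nu> m)"
  by (auto simp: polys_less_def annihilates_keys_iff kills_degree_def)

lemma annihilates_polys_le_iff:
  "linear \<nu> \<Longrightarrow> \<nu> \<bottom>\<^sub>f polys_le k \<longleftrightarrow> (\<forall>m\<le>k. kills_degree \<nu> m)"
  by (auto simp: polys_le_def annihilates_keys_iff kills_degree_def)

section \<open>Expansion of the power of the squared distance\<close>

lemma tensor_expansion_term:
  assumes "linear \<nu>" "linear \<mu>"
  shows "(\<nu> \<otimes>\<^sub>f \<mu>) (sqnorm Inl ^ j * (sqnorm Inr ^ n * inner_poly ^ m)) =
    (mult_dual (sqnorm (\<lambda>i. i) ^ j) \<nu> \<otimes>\<^sub>f mult_dual (sqnorm (\<lambda>i. i) ^ n) \<mu>) (inner_poly ^ m)"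
proof -
  have "(\<nu> \<otimes>\<^sub>f \<mu>) (sqnorm Inl ^ j * (sqnorm Inr ^ n * inner_poly ^ m)) =
    mult_dual (sqnorm Inr ^ n) (mult_dual (sqnorm Inl ^ j) (\<nu> \<otimes>\<^sub>f \<mu>)) (inner_poly ^ m)"
    by (simp add: mult_dual_def)
  then show ?thesis
    by (simp add: assms tensor_sqnorm_Inl_power tensor_sqnorm_Inr_power)
qed

lemma tensor_expansion_term_eq_0:
  assumes "linear \<nu>" "linear \<mu>" "kills_degree \<nu> (m + 2 * j) \<or> kills_degree \<mu> (m + 2 * n)"
  shows "(\<nu> \<otimes>\<^sub>f \<mu>) (sqnorm Inl ^ j * (sqnorm Inr ^ n * inner_poly ^ m)) = 0"
  using assms
  by (auto simp: tensor_expansion_term intro!: tensor_inner_power_eq_0 kills_degree_sqnorm_power)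

text \<open>Two nested binomial expansions. Keeping the coefficients in \<open>of_int\<close> form
  lets a linear functional pull them out as real scalars.\<close>

lemma trinomial_expansion:
  fixes A B C :: "'a::comm_ring_1"
  shows "(of_int c * C + (A + B)) ^ k =
    (\<Sum>m\<le>k. \<Sum>j\<le>k-m. of_int (int (k choose m) * int ((k - m) choose j) * c ^ m) *
      (A ^ j * (B ^ (k - m - j) * C ^ m)))"
proof -
  have "(of_int c * C + (A + B)) ^ k =
    (\<Sum>m\<le>k. of_nat (k choose m) * (of_int c * C) ^ m *
      (\<Sum>j\<le>k-m. of_nat ((k - m) choose j) * A ^ j * B ^ (k - m - j)))"
    by (simp only: binomial_ring[of "of_int c * C" "A + B"] binomial_ring[of A B])
  also have "\<dots> = (\<Sum>m\<le>k. \<Sum>j\<le>k-m. of_nat (k choose m) * (of_int c * C) ^ m *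
      (of_nat ((k - m) choose j) * A ^ j * B ^ (k - m - j)))"
    by (simp only: sum_distrib_left)
  also have "\<dots> = (\<Sum>m\<le>k. \<Sum>j\<le>k-m.
      of_int (int (k choose m) * int ((k - m) choose j) * c ^ m) *
      (A ^ j * (B ^ (k - m - j) * C ^ m)))"
    by (intro sum.cong refl) (simp add: power_mult_distrib mult_ac)
  finally show ?thesis .
qed

lemma tensor_sqdist_expansion:
  "(\<nu> \<otimes>\<^sub>f \<mu>) (sqdist_poly ^ k) = (\<Sum>m\<le>k. \<Sum>j\<le>k-m.
    of_nat (k choose m) * of_nat ((k - m) choose j) * (-2) ^ m *
    (\<nu> \<otimes>\<^sub>f \<mu>) (sqnorm Inl ^ j * (sqnorm Inr ^ (k - m - j) * inner_poly ^ m)))"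
  unfolding sqdist_poly_eq trinomial_expansion
  by (subst linear_sum[OF linear_tensor], subst linear_sum[OF linear_tensor],
      subst linear_of_int_mult[OF linear_tensor]) simp

theorem mainTheorem1:
  fixes \<Lambda> :: "'n::finite rpoly \<Rightarrow> real" and k :: nat
  assumes "linear \<Lambda>"
    and "\<Lambda> \<bottom>\<^sub>f polys_less k"
  shows "(-1) ^ k * (\<Lambda> \<otimes>\<^sub>f \<Lambda>) (sqdist_poly ^ k) \<ge> 0 \<and>
    ((-1) ^ k * (\<Lambda> \<otimes>\<^sub>f \<Lambda>) (sqdist_poly ^ k) = 0 \<longleftrightarrow> \<Lambda> \<bottom>\<^sub>f polys_le k)"
proof -
  define E where "E m j = (\<Lambda> \<otimes>\<^sub>f \<Lambda>) (sqnorm Inl ^ j * (sqnorm Inr ^ (k - m - j) * inner_poly ^ m))"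
    for m j
  define t where "t m j =
    (-1) ^ k * (of_nat (k choose m) * of_nat ((k - m) choose j) * (-2) ^ m * E m j)" for m j
  have expand: "(-1) ^ k * (\<Lambda> \<otimes>\<^sub>f \<Lambda>) (sqdist_poly ^ k) = (\<Sum>m\<le>k. \<Sum>j\<le>k-m. t m j)"
    unfolding tensor_sqdist_expansion t_def E_def by (simp add: sum_distrib_left)
  have less: "kills_degree \<Lambda> m" if "m < k" for m
    using assms that by (simp add: annihilates_polys_less_iff)
  have t_nonneg: "t m j \<ge> 0" if "m \<le> k" "j \<le> k - m" for m j
  proof (cases "k = m + 2 * j")
    case True
    \<comment> \<open>Since \<open>k = m + 2 * j\<close>, the sign is \<open>(-1) ^ m\<close>, and
      it combines with \<open>(-2) ^ m\<close>.\<close>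
    have "(-1) ^ k * (-2) ^ m = (2 ^ m :: real)"
      by (simp add: True power_add power_mult flip: power_mult_distrib)
    \<comment> \<open>Here \<open>k - m - j = j\<close>, so both tensor factors are the same
      functional.\<close>
    moreover have "E m j \<ge> 0"
      using True by (simp add: E_def tensor_expansion_term assms(1) tensor_inner_power_nonneg)
    moreover have "t m j = ((-1) ^ k * (-2) ^ m) * (of_nat (k choose m) * of_nat ((k - m) choose j) * E m j)"
      by (simp add: t_def)
    ultimately show ?thesis by simp
  next
    case False
    \<comment> \<open>The x-degree and the y-degree add up to \<open>2 * k\<close>; if one differs
      from \<open>k\<close>, one of them lies below \<open>k\<close>.\<close>
    then have "m + 2 * j < k \<or> m + 2 * (k - m - j) < k"
      using that by linarith
    then have "E m j = 0"
      unfolding E_def using assms(1) less by (intro tensor_expansion_term_eq_0) auto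
    then show ?thesis by (simp add: t_def)
  qed
  have "\<Lambda> \<bottom>\<^sub>f polys_le k" if "(\<Sum>m\<le>k. \<Sum>j\<le>k-m. t m j) = 0"
  proof -
    have "\<forall>m\<in>{..k}. (\<Sum>j\<le>k-m. t m j) = 0"
      using that by (subst (asm) sum_nonneg_eq_0_iff) (auto intro!: sum_nonneg t_nonneg)
    \<comment> \<open>For \<open>m = k\<close> only \<open>j = 0\<close> occurs: this is the pure
      power of C, with the nonzero coefficient \<open>(-1) ^ k * (-2) ^ k\<close>.\<close>
    from bspec[OF this, of k] have "t k 0 = 0" by simp
    then have "(\<Lambda> \<otimes>\<^sub>f \<Lambda>) (inner_poly ^ k) = 0"
      by (simp add: t_def E_def)
    then have "kills_degree \<Lambda> k"
      by (simp add: tensor_inner_power_eq_0_iff)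
    with less assms(1) show ?thesis
      by (auto simp: annihilates_polys_le_iff le_less)
  qed
  moreover have "(\<Sum>m\<le>k. \<Sum>j\<le>k-m. t m j) = 0" if "\<Lambda> \<bottom>\<^sub>f polys_le k"
  proof -
    have "t m j = 0" if "m \<le> k" "j \<le> k - m" for m j
    proof -
      \<comment> \<open>Two degrees with sum \<open>2 * k\<close> cannot both exceed
        \<open>k\<close>, so now the diagonal terms vanish as well.\<close>
      have "m + 2 * j \<le> k \<or> m + 2 * (k - m - j) \<le> k"
        using that by linarith
      then have "E m j = 0"
        unfolding E_def using assms(1) \<open>\<Lambda> \<bottom>\<^sub>f polys_le k\<close>
        by (intro tensor_expansion_term_eq_0) (auto simp: annihilates_polys_le_iff)
      then show ?thesis by (simp add: t_def)
    qed
    then show ?thesis by simp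
  qed
  ultimately show ?thesis
    unfolding expand by (auto intro!: sum_nonneg t_nonneg)
qed

end
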